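(* For any $\varepsilon>0$, $\beta\in(0,1)$ and $n\in\mathbb{N}$, there exists an algorithm $\mathcal{M}\colon\mathcal{X}^n\to\mathcal{R}$ (for some domain $\mathcal{X}$ and range $\mathcal{R}$) that is $(\varepsilon,0)$-differentially private, but not $(\beta,\varepsilon',0)$-perfectly generalizing for any $\varepsilon'=o\left(\varepsilon\sqrt{n\ln(1/\beta)}\right)$.
   Context: $(\varepsilon,\delta)$-closeness of distributions $\mathcal{J}_1,\mathcal{J}_2$ over $\mathcal{R}$: for every $\mathcal{O}\subseteq\mathcal{R}$, $\Pr_{\mathcal{J}_1}[\mathcal{O}]\le e^{\varepsilon}\Pr_{\mathcal{J}_2}[\mathcal{O}]+\delta$ and vice versa. $\mathcal{M}$ is $(\varepsilon,\delta)$-differentially private if $\mathcal{M}(T),\mathcal{M}(T')$ are $(\varepsilon,\delta)$-close for all $T,T'\in\mathcal{X}^n$ differing in exactly one element. $\mathcal{M}$ is $(\beta,\varepsilon,\delta)$-perfectly generalizing if for every distribution $\mathcal{C}$ over $\mathcal{X}$ there is a distribution $\mathrm{Sim}_{\mathcal{C}}$ over $\mathcal{R}$ such that with probability at least $1-\beta$ over $T\sim_{i.i.d.}\mathcal{C}^n$, $\mathcal{M}(T)$ and $\mathrm{Sim}_{\mathcal{C}}$ are $(\varepsilon,\delta)$-close.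
   Formalization: The little-o is taken along sequences of (ε, β, n) with the added condition ln(1/β) = O(n), automatic for fixed β and n → ∞; without it the claim fails (n = 1, β → 0), since every (ε,0)-DP algorithm is (0, nε, 0)-perfectly generalizing. *)

theory Defs
  imports "HOL-Probability.Probability" "HOL-Library.Landau_Symbols"
begin

(* Domains and ranges are subsets of countable types, equipped with the discrete sigma-algebra.
   There every probability distribution is a pmf, so quantifying over pmfs supported in a set
   is quantifying over all distributions over that set. *)

definition close_on :: "'r::countable set \<Rightarrow> real \<Rightarrow> real \<Rightarrow> 'r pmf \<Rightarrow> 'r pmf \<Rightarrow> bool" where
  "close_on R \<epsilon> \<delta> J1 J2 \<longleftrightarrow>
     (\<forall>Q\<subseteq>R. measure_pmf.prob J1 Q \<le> exp \<epsilon> * measure_pmf.prob J2 Q + \<delta> \<and>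
            measure_pmf.prob J2 Q \<le> exp \<epsilon> * measure_pmf.prob J1 Q + \<delta>)"

definition samples :: "'x set \<Rightarrow> nat \<Rightarrow> 'x list set" where
  "samples X n = {T. set T \<subseteq> X \<and> length T = n}"

definition algorithm ::
    "'x::countable set \<Rightarrow> nat \<Rightarrow> 'r::countable set \<Rightarrow> ('x list \<Rightarrow> 'r pmf) \<Rightarrow> bool" where
  "algorithm X n R M \<longleftrightarrow> (\<forall>T\<in>samples X n. set_pmf (M T) \<subseteq> R)"

definition differ_in_one :: "'x list \<Rightarrow> 'x list \<Rightarrow> bool" where
  "differ_in_one T T' \<longleftrightarrow> length T = length T' \<and> card {i. i < length T \<and> T ! i \<noteq> T' ! i} = 1"

definition differentially_private ::
    "'x::countable set \<Rightarrow> nat \<Rightarrow> 'r::countable set \<Rightarrow> real \<Rightarrow> real \<Rightarrow> ('x list \<Rightarrow> 'r pmf) \<Rightarrow> bool" where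
  "differentially_private X n R \<epsilon> \<delta> M \<longleftrightarrow>
     (\<forall>T\<in>samples X n. \<forall>T'\<in>samples X n. differ_in_one T T' \<longrightarrow> close_on R \<epsilon> \<delta> (M T) (M T'))"

definition perfectly_generalizing ::
    "'x::countable set \<Rightarrow> nat \<Rightarrow> 'r::countable set \<Rightarrow> real \<Rightarrow> real \<Rightarrow> real \<Rightarrow> ('x list \<Rightarrow> 'r pmf) \<Rightarrow> bool" where
  "perfectly_generalizing X n R \<beta> \<epsilon> \<delta> M \<longleftrightarrow>
     (\<forall>C. set_pmf C \<subseteq> X \<longrightarrow>
       (\<exists>Sim. set_pmf Sim \<subseteq> R \<and>
          measure_pmf.prob (replicate_pmf n C) {T. close_on R \<epsilon> \<delta> (M T) Sim} \<ge> 1 - \<beta>))"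

end

theory Submission
  imports Defs
begin

text \<open>
  Let the data be points of a large finite set and let the exponential mechanism choose a list
  \<open>r\<close> of \<open>n\<close> points, scored by the number of data points occurring in \<open>r\<close>. For
  datasets \<open>T\<close> and \<open>T'\<close> with disjoint supports, the outputs \<open>T\<close> and \<open>T'\<close>
  have scores \<open>n\<close> and \<open>0\<close> in opposite orders, so the two output distributions cannot both be
  \<open>\<epsilon>'\<close>-close to a common distribution unless \<open>\<epsilon> n \<le> 4 \<epsilon>'\<close>. Under uniform sampling a
  dataset is disjoint from a fixed one with probability at least \<open>1 - n\<^sup>2 / |X|\<close>, which exceeds
  \<open>\<beta>\<close> once \<open>X\<close> is large. Hence the failure of generalization is even linear in
  \<open>n\<close>, and \<open>ln (1 / \<beta>) = O(n)\<close> makes \<open>\<epsilon> n\<close> dominate \<open>\<epsilon> sqrt (n ln (1 / \<beta>))\<close>.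
\<close>

section \<open>The exponential mechanism and its probability mass function\<close>

definition score :: "'a list \<Rightarrow> 'a list \<Rightarrow> nat" where
  "score T r = card {i. i < length T \<and> T ! i \<in> set r}"

text \<open>The exponent uses half of \<open>\<epsilon>\<close> because a change of one data point
  acts twice on an output probability: on the weight and on the normalizing sum.\<close>

definition exp_weight :: "real \<Rightarrow> 'a list \<Rightarrow> 'a list \<Rightarrow> real" where
  "exp_weight \<epsilon> T r = exp (\<epsilon> / 2 * real (score T r))"

definition exp_mechanism :: "real \<Rightarrow> 'a list set \<Rightarrow> 'a list \<Rightarrow> 'a list pmf" where
  "exp_mechanism \<epsilon> R T =
     embed_pmf (\<lambda>r. if r \<in> R then exp_weight \<epsilon> T r / sum (exp_weight \<epsilon> T) R else 0)"

lemma exp_weight_pos: "exp_weight \<epsilon> T r > 0"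
  by (simp add: exp_weight_def)

lemma sum_exp_weight_pos:
  assumes "finite R" "R \<noteq> {}"
  shows "sum (exp_weight \<epsilon> T) R > 0"
  using assms by (intro sum_pos exp_weight_pos)

lemma pmf_exp_mechanism:
  assumes "finite R" "R \<noteq> {}"
  shows "pmf (exp_mechanism \<epsilon> R T) r =
    (if r \<in> R then exp_weight \<epsilon> T r / sum (exp_weight \<epsilon> T) R else 0)"
  unfolding exp_mechanism_def
proof (rule pmf_embed_pmf)
  let ?f = "\<lambda>r. if r \<in> R then exp_weight \<epsilon> T r / sum (exp_weight \<epsilon> T) R else 0"
  show nonneg: "0 \<le> ?f r" for r
    using sum_exp_weight_pos[OF assms, of \<epsilon> T] exp_weight_pos[of \<epsilon> T r] by simp
  have "(\<integral>\<^sup>+r. ennreal (?f r) \<partial>count_space UNIV) = (\<Sum>r\<in>R. ennreal (?f r))"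
    by (rule nn_integral_count_space') (use assms in \<open>auto split: if_splits\<close>)
  also have "\<dots> = ennreal (\<Sum>r\<in>R. ?f r)"
    by (rule sum_ennreal) (rule nonneg)
  also have "(\<Sum>r\<in>R. ?f r) = 1"
    using sum_exp_weight_pos[OF assms, of \<epsilon> T] by (simp flip: sum_divide_distrib)
  finally show "(\<integral>\<^sup>+r. ennreal (?f r) \<partial>count_space UNIV) = 1" by simp
qed

lemma set_pmf_exp_mechanism:
  assumes "finite R" "R \<noteq> {}"
  shows "set_pmf (exp_mechanism \<epsilon> R T) \<subseteq> R"
  by (auto simp: set_pmf_iff pmf_exp_mechanism[OF assms] split: if_splits)

section \<open>Privacy of the exponential mechanism\<close>

lemma differ_in_one_sym: "differ_in_one T T' \<Longrightarrow> differ_in_one T' T"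
  unfolding differ_in_one_def by (auto simp: eq_commute)

lemma score_differ_in_one:
  assumes "differ_in_one T T'"
  shows "score T r \<le> score T' r + 1"
proof -
  have len: "length T = length T'"
    and "card {i. i < length T \<and> T ! i \<noteq> T' ! i} = 1"
    using assms by (auto simp: differ_in_one_def)
  then obtain j where j: "{i. i < length T \<and> T ! i \<noteq> T' ! i} = {j}"
    by (meson card_1_singletonE)
  have "{i. i < length T \<and> T ! i \<in> set r} \<subseteq> insert j {i. i < length T' \<and> T' ! i \<in> set r}"
  proof
    fix i assume i: "i \<in> {i. i < length T \<and> T ! i \<in> set r}"
    show "i \<in> insert j {i. i < length T' \<and> T' ! i \<in> set r}"
    proof (cases "T ! i = T' ! i")
      case False
      then have "i \<in> {i. i < length T \<and> T ! i \<noteq> T' ! i}" using i by simp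
      then show ?thesis using j by simp
    qed (use i len in auto)
  qed
  then have "score T r \<le> card (insert j {i. i < length T' \<and> T' ! i \<in> set r})"
    unfolding score_def by (intro card_mono) auto
  also have "\<dots> \<le> score T' r + 1"
    unfolding score_def by (simp add: card_insert_if)
  finally show ?thesis .
qed

lemma exp_weight_differ_in_one:
  assumes "differ_in_one T T'" "\<epsilon> \<ge> 0"
  shows "exp_weight \<epsilon> T r \<le> exp (\<epsilon> / 2) * exp_weight \<epsilon> T' r"
proof -
  have "\<epsilon> / 2 * real (score T r) \<le> \<epsilon> / 2 * (real (score T' r) + 1)"
    using score_differ_in_one[OF assms(1), of r] assms(2) by (intro mult_left_mono) auto
  then show ?thesis
    unfolding exp_weight_def by (simp add: algebra_simps flip: exp_add)
qed

text \<open>Passing from \<open>T'\<close> to \<open>T\<close> raises the weight of \<open>r\<close>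
  by at most a factor \<open>exp (\<epsilon> / 2)\<close> and shrinks the normalizing sum by at most
  the same factor.\<close>

lemma pmf_exp_mechanism_differ_in_one:
  assumes R: "finite R" "R \<noteq> {}" and diff: "differ_in_one T T'" and "\<epsilon> \<ge> 0"
  shows "pmf (exp_mechanism \<epsilon> R T) r \<le> exp \<epsilon> * pmf (exp_mechanism \<epsilon> R T') r"
proof (cases "r \<in> R")
  case True
  let ?Z = "sum (exp_weight \<epsilon> T) R" and ?Z' = "sum (exp_weight \<epsilon> T') R"
  have pos: "?Z > 0" "?Z' > 0" by (rule sum_exp_weight_pos[OF R])+
  have Z: "?Z' \<le> exp (\<epsilon> / 2) * ?Z"
    unfolding sum_distrib_left
    by (intro sum_mono exp_weight_differ_in_one[OF differ_in_one_sym[OF diff]] \<open>\<epsilon> \<ge> 0\<close>)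
  have "exp_weight \<epsilon> T r * ?Z' \<le> (exp (\<epsilon> / 2) * exp_weight \<epsilon> T' r) * (exp (\<epsilon> / 2) * ?Z)"
    using pos exp_weight_pos[of \<epsilon> T' r]
    by (intro mult_mono exp_weight_differ_in_one diff \<open>\<epsilon> \<ge> 0\<close> Z) auto
  also have "\<dots> = (exp (\<epsilon> / 2) * exp (\<epsilon> / 2)) * exp_weight \<epsilon> T' r * ?Z"
    by (simp only: mult_ac)
  also have "exp (\<epsilon> / 2) * exp (\<epsilon> / 2) = exp \<epsilon>"
    by (simp flip: exp_add)
  finally show ?thesis
    using True pos by (simp add: pmf_exp_mechanism[OF R] field_simps)
qed (simp add: pmf_exp_mechanism[OF R])

lemma close_on_0_pmfI:
  assumes "finite R"
    and "\<And>r. r \<in> R \<Longrightarrow> pmf p r \<le> exp \<epsilon> * pmf q r"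
    and "\<And>r. r \<in> R \<Longrightarrow> pmf q r \<le> exp \<epsilon> * pmf p r"
  shows "close_on R \<epsilon> 0 p q"
  unfolding close_on_def
proof (intro allI impI conjI)
  fix Q assume Q: "Q \<subseteq> R"
  then have "finite Q" using assms(1) finite_subset by blast
  with Q show "measure_pmf.prob p Q \<le> exp \<epsilon> * measure_pmf.prob q Q + 0"
    and "measure_pmf.prob q Q \<le> exp \<epsilon> * measure_pmf.prob p Q + 0"
    by (auto simp: measure_measure_pmf_finite sum_distrib_left intro!: sum_mono assms(2,3))
qed

lemma close_on_0_pmfD:
  assumes "close_on R \<epsilon> 0 p q" "r \<in> R"
  shows "pmf p r \<le> exp \<epsilon> * pmf q r" "pmf q r \<le> exp \<epsilon> * pmf p r"
  using assms(1)[unfolded close_on_def, rule_format, of "{r}"] assms(2)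
  by (auto simp: measure_pmf_single)

lemma differentially_private_exp_mechanism:
  assumes "finite R" "R \<noteq> {}" "\<epsilon> \<ge> 0"
  shows "differentially_private X n R \<epsilon> 0 (exp_mechanism \<epsilon> R)"
  unfolding differentially_private_def
  by (intro ballI impI close_on_0_pmfI pmf_exp_mechanism_differ_in_one assms)
    (simp_all add: differ_in_one_sym)

section \<open>Outputs on datasets with disjoint supports\<close>

lemma score_self: "score T T = length T"
proof -
  have "{i. i < length T \<and> T ! i \<in> set T} = {..<length T}" by auto
  then show ?thesis by (simp add: score_def)
qed

lemma score_disjoint:
  assumes "set T \<inter> set r = {}"
  shows "score T r = 0"
proof -
  have "{i. i < length T \<and> T ! i \<in> set r} = {}" using assms by (auto dest: nth_mem)
  then show ?thesis by (simp add: score_def)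
qed

text \<open>Going through \<open>S\<close> compares the two mechanisms at the cost of a factor
  \<open>exp (2 * \<epsilon>')\<close>. The comparison is made at the outputs \<open>T\<close> and
  \<open>T'\<close>, where the scores are \<open>n\<close> and 0 in opposite orders.\<close>

lemma exp_mechanism_disjoint_far:
  assumes fin: "finite R" and T: "T \<in> R" "length T = n" and T': "T' \<in> R" "length T' = n"
    and disj: "set T \<inter> set T' = {}"
    and close: "close_on R \<epsilon>' 0 (exp_mechanism \<epsilon> R T) S" "close_on R \<epsilon>' 0 (exp_mechanism \<epsilon> R T') S"
  shows "\<epsilon> * real n \<le> 4 * \<epsilon>'"
proof -
  have R: "finite R" "R \<noteq> {}" using fin T by auto
  let ?Z = "sum (exp_weight \<epsilon> T) R" and ?Z' = "sum (exp_weight \<epsilon> T') R"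
  have pos: "?Z > 0" "?Z' > 0" by (rule sum_exp_weight_pos[OF R])+
  have disj': "set T' \<inter> set T = {}" using disj by blast
  have double: "exp \<epsilon>' * (exp \<epsilon>' * x) = exp (2 * \<epsilon>') * x" for x
    by (simp add: exp_double power2_eq_square)
  have "pmf (exp_mechanism \<epsilon> R T) T \<le> exp \<epsilon>' * (exp \<epsilon>' * pmf (exp_mechanism \<epsilon> R T') T)"
    using close_on_0_pmfD(1)[OF close(1) T(1)] close_on_0_pmfD(2)[OF close(2) T(1)]
    by (meson exp_ge_zero mult_left_mono order_trans)
  then have 1: "exp (\<epsilon> / 2 * n) * ?Z' \<le> exp (2 * \<epsilon>') * ?Z"
    using pos T disj' unfolding double
    by (simp add: pmf_exp_mechanism[OF R] exp_weight_def[of _ _ T] score_self score_disjoint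
        field_simps)
  have "pmf (exp_mechanism \<epsilon> R T') T' \<le> exp \<epsilon>' * (exp \<epsilon>' * pmf (exp_mechanism \<epsilon> R T) T')"
    using close_on_0_pmfD(1)[OF close(2) T'(1)] close_on_0_pmfD(2)[OF close(1) T'(1)]
    by (meson exp_ge_zero mult_left_mono order_trans)
  then have 2: "exp (\<epsilon> / 2 * n) * ?Z \<le> exp (2 * \<epsilon>') * ?Z'"
    using pos T' disj unfolding double
    by (simp add: pmf_exp_mechanism[OF R] exp_weight_def[of _ _ T'] score_self score_disjoint
        field_simps)
  \<comment> \<open>The unknown ratio of the normalizing sums enters \<open>1\<close> and
    \<open>2\<close> inversely, so it cancels in their product.\<close>
  have "(exp (\<epsilon> / 2 * n) * ?Z') * (exp (\<epsilon> / 2 * n) * ?Z)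
      \<le> (exp (2 * \<epsilon>') * ?Z) * (exp (2 * \<epsilon>') * ?Z')"
    using pos by (intro mult_mono 1 2) auto
  then have "(exp (\<epsilon> / 2 * n) * exp (\<epsilon> / 2 * n)) * (?Z * ?Z')
      \<le> (exp (2 * \<epsilon>') * exp (2 * \<epsilon>')) * (?Z * ?Z')"
    by (simp only: mult_ac)
  then have "exp (\<epsilon> / 2 * n) * exp (\<epsilon> / 2 * n) \<le> exp (2 * \<epsilon>') * exp (2 * \<epsilon>')"
    using pos by (simp only: mult_le_cancel_right) simp
  then show ?thesis by (simp flip: exp_add)
qed

section \<open>Probability that a sample meets a fixed set\<close>

lemma prob_replicate_pmf_hits:
  "measure_pmf.prob (replicate_pmf n C) {T. set T \<inter> A \<noteq> {}} \<le> real n * measure_pmf.prob C A"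
proof (induction n)
  case 0
  then show ?case by simp
next
  case (Suc n)
  let ?P = "pair_pmf C (replicate_pmf n C)"
  have "measure_pmf.prob (replicate_pmf (Suc n) C) {T. set T \<inter> A \<noteq> {}}
      = measure_pmf.prob (map_pmf (\<lambda>(x, T). x # T) ?P) {T. set T \<inter> A \<noteq> {}}"
    by (simp add: pair_pmf_def map_bind_pmf map_pmf_def bind_assoc_pmf bind_return_pmf)
  \<comment> \<open>Union bound: either the first draw or one of the remaining \<open>n\<close>
    draws lies in \<open>A\<close>.\<close>
  also have "\<dots> \<le> measure_pmf.prob ?P (fst -` A \<union> snd -` {T. set T \<inter> A \<noteq> {}})"
    by (auto intro!: measure_pmf.finite_measure_mono)
  also have "\<dots> \<le> measure_pmf.prob ?P (fst -` A)
      + measure_pmf.prob ?P (snd -` {T. set T \<inter> A \<noteq> {}})"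
    by (rule measure_Un_le) auto
  also have "\<dots> = measure_pmf.prob (map_pmf fst ?P) A
      + measure_pmf.prob (map_pmf snd ?P) {T. set T \<inter> A \<noteq> {}}"
    by simp
  also have "\<dots> \<le> real (Suc n) * measure_pmf.prob C A"
    using Suc.IH by (simp only: map_fst_pair_pmf map_snd_pair_pmf) (simp add: algebra_simps)
  finally show ?case .
qed

section \<open>Failure of generalization under uniform sampling\<close>

lemma finite_samples: "finite X \<Longrightarrow> finite (samples X n)"
  unfolding samples_def by (rule finite_lists_length_eq)

lemma samples_nonempty:
  assumes "X \<noteq> {}"
  shows "samples X n \<noteq> {}"
proof -
  obtain x where "x \<in> X" using assms by blast
  then have "replicate n x \<in> samples X n" by (auto simp: samples_def)
  then show ?thesis by blast
qed

text \<open>Fix one dataset whose output is close to the simulator. By \<open>small\<close>, every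
  other such dataset must share a point with it, but under the uniform distribution this has
  probability at most \<open>n * (n / card X)\<close>, which is below
  \<open>1 - \<beta>\<close>.\<close>

lemma not_perfectly_generalizing_exp_mechanism:
  fixes X :: "'a::countable set"
  assumes X: "finite X" "X \<noteq> {}" and large: "(real n)\<^sup>2 / card X < 1 - \<beta>"
    and small: "4 * \<epsilon>' < \<epsilon> * real n"
  shows "\<not> perfectly_generalizing X n (samples X n) \<beta> \<epsilon>' 0 (exp_mechanism \<epsilon> (samples X n))"
proof
  let ?R = "samples X n" and ?C = "pmf_of_set X"
  let ?P = "replicate_pmf n ?C"
  assume "perfectly_generalizing X n ?R \<beta> \<epsilon>' 0 (exp_mechanism \<epsilon> ?R)"
  then obtain S where
    S: "measure_pmf.prob ?P {T. close_on ?R \<epsilon>' 0 (exp_mechanism \<epsilon> ?R T) S} \<ge> 1 - \<beta>"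
    unfolding perfectly_generalizing_def using X by (metis set_pmf_of_set order_refl)
  \<comment> \<open>Intersecting with \<open>?R\<close>, which has full probability, provides the
    length \<open>n\<close> needed to compare scores.\<close>
  define G where "G = {T \<in> ?R. close_on ?R \<epsilon>' 0 (exp_mechanism \<epsilon> ?R T) S}"
  have "set_pmf ?P = ?R"
    using X by (auto simp: set_replicate_pmf samples_def lists_eq_set)
  then have "measure_pmf.prob ?P {T. close_on ?R \<epsilon>' 0 (exp_mechanism \<epsilon> ?R T) S}
      = measure_pmf.prob ?P G"
    unfolding G_def by (intro measure_pmf.finite_measure_eq_AE) (auto simp: AE_measure_pmf_iff)
  with S have prob_G: "measure_pmf.prob ?P G \<ge> 1 - \<beta>" by simp
  have "1 - \<beta> > 0" using large by (smt (verit) divide_nonneg_nonneg of_nat_0_le_iff zero_le_power2)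
  with prob_G have "G \<noteq> {}" by auto
  then obtain T\<^sub>0 where T\<^sub>0: "T\<^sub>0 \<in> G" by blast
  have "G \<subseteq> {T. set T \<inter> set T\<^sub>0 \<noteq> {}}"
    using exp_mechanism_disjoint_far[OF finite_samples[OF X(1)], of _ n n T\<^sub>0 \<epsilon>' \<epsilon> S] T\<^sub>0 small
    by (fastforce simp: G_def samples_def)
  then have "measure_pmf.prob ?P G \<le> measure_pmf.prob ?P {T. set T \<inter> set T\<^sub>0 \<noteq> {}}"
    by (intro measure_pmf.finite_measure_mono) auto
  also have "\<dots> \<le> real n * measure_pmf.prob ?C (set T\<^sub>0)"
    by (rule prob_replicate_pmf_hits)
  also have "measure_pmf.prob ?C (set T\<^sub>0) = card (X \<inter> set T\<^sub>0) / card X"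
    by (rule measure_pmf_of_set) (use X in auto)
  also have "real n * (card (X \<inter> set T\<^sub>0) / card X) \<le> real n * (real n / card X)"
  proof -
    have "card (X \<inter> set T\<^sub>0) \<le> card (set T\<^sub>0)" by (intro card_mono) auto
    also have "\<dots> \<le> n" using card_length[of T\<^sub>0] T\<^sub>0 by (simp add: G_def samples_def)
    finally show ?thesis by (intro mult_left_mono divide_right_mono) auto
  qed
  also have "\<dots> = (real n)\<^sup>2 / card X" by (simp add: power2_eq_square)
  finally show False using prob_G large by simp
qed

section \<open>Asymptotic comparison with a linear bound\<close>

lemma eventually_smallo_linear:
  fixes \<epsilon> \<epsilon>' L :: "nat \<Rightarrow> real" and n :: "nat \<Rightarrow> nat"
  assumes pos: "\<And>k. \<epsilon> k > 0" "\<And>k. L k > 0"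
    and L: "L \<in> O(\<lambda>k. real (n k))"
    and eps': "\<epsilon>' \<in> o(\<lambda>k. \<epsilon> k * sqrt (real (n k) * L k))"
  shows "\<forall>\<^sub>F k in sequentially. 4 * \<epsilon>' k < \<epsilon> k * real (n k)"
proof -
  obtain K where K: "K > 0" "\<forall>\<^sub>F k in sequentially. norm (L k) \<le> K * norm (real (n k))"
    using L by (elim landau_o.bigE)
  \<comment> \<open>\<open>sqrt K\<close> absorbs the constant of the big-O bound. The 8 leaves
    \<open>4 * \<epsilon>' k\<close> at most half of \<open>\<epsilon> k * real (n k)\<close>,
    whence the strict inequality.\<close>
  have "\<forall>\<^sub>F k in sequentially.
      norm (\<epsilon>' k) \<le> 1 / (8 * sqrt K) * norm (\<epsilon> k * sqrt (real (n k) * L k))"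
    using K(1) by (intro landau_o.smallD[OF eps']) simp
  with K(2) show ?thesis
  proof eventually_elim
    case (elim k)
    have Lk: "L k \<le> K * real (n k)" using elim(1) pos(2)[of k] by simp
    \<comment> \<open>\<open>L k\<close> is positive, so the big-O bound excludes
      \<open>n k = 0\<close>.\<close>
    have n: "real (n k) > 0" using Lk pos(2)[of k] by (cases "n k = 0") auto
    have "sqrt (real (n k) * L k) \<le> sqrt (real (n k) * (K * real (n k)))"
      using Lk n by (intro real_sqrt_le_mono mult_left_mono) auto
    also have "\<dots> = sqrt K * real (n k)"
      using n by (simp add: real_sqrt_mult)
    finally have root: "sqrt (real (n k) * L k) \<le> sqrt K * real (n k)" .
    have "\<epsilon>' k \<le> 1 / (8 * sqrt K) * (\<epsilon> k * sqrt (real (n k) * L k))"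
      using elim(2) pos[of k] by (simp add: abs_mult)
    also have "\<dots> \<le> 1 / (8 * sqrt K) * (\<epsilon> k * (sqrt K * real (n k)))"
      using root pos(1)[of k] K(1) by (intro mult_left_mono) auto
    also have "\<dots> = \<epsilon> k * real (n k) / 8" using K(1) by simp
    finally have "4 * \<epsilon>' k \<le> \<epsilon> k * real (n k) / 2" by simp
    also have "\<dots> < \<epsilon> k * real (n k)" using n pos(1)[of k] by simp
    finally show ?case .
  qed
qed

(* The algorithm (with its domain and range) depends only on (eps, beta, n).  The little-o is joint in
   all parameters: they form an arbitrary sequence (eps k, beta k, n k), some of them possibly fixed;
   fixed eps and beta with n k = k is the usual "n tends to infinity".
   The condition ln (1/beta) = O(n) holds trivially there.  In general it cannot be dropped: by group
   privacy every (eps,0)-differentially private algorithm is (0, n*eps, 0)-perfectly generalizing, and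
   n*eps is o(eps * sqrt (n * ln (1/beta))) along any sequence where ln (1/beta) / n tends to infinity. *)
theorem theorem5p5:
  shows "\<exists>(X :: real \<Rightarrow> real \<Rightarrow> nat \<Rightarrow> nat set) (R :: real \<Rightarrow> real \<Rightarrow> nat \<Rightarrow> nat list set)
          (M :: real \<Rightarrow> real \<Rightarrow> nat \<Rightarrow> nat list \<Rightarrow> nat list pmf).
     (\<forall>\<epsilon>>0. \<forall>\<beta>\<in>{0<..<1}. \<forall>n.
        algorithm (X \<epsilon> \<beta> n) n (R \<epsilon> \<beta> n) (M \<epsilon> \<beta> n) \<and>
        differentially_private (X \<epsilon> \<beta> n) n (R \<epsilon> \<beta> n) \<epsilon> 0 (M \<epsilon> \<beta> n)) \<and>
     (\<forall>(\<epsilon> :: nat \<Rightarrow> real) (\<beta> :: nat \<Rightarrow> real) (n :: nat \<Rightarrow> nat) (\<epsilon>' :: nat \<Rightarrow> real).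
        (\<forall>k. \<epsilon> k > 0 \<and> \<beta> k \<in> {0<..<1}) \<longrightarrow>
        (\<lambda>k. ln (1 / \<beta> k)) \<in> O(\<lambda>k. real (n k)) \<longrightarrow>
        \<epsilon>' \<in> o(\<lambda>k. \<epsilon> k * sqrt (real (n k) * ln (1 / \<beta> k))) \<longrightarrow>
        (\<forall>\<^sub>F k in sequentially.
           \<not> perfectly_generalizing (X (\<epsilon> k) (\<beta> k) (n k)) (n k) (R (\<epsilon> k) (\<beta> k) (n k))
               (\<beta> k) (\<epsilon>' k) 0 (M (\<epsilon> k) (\<beta> k) (n k))))"
proof -
  \<comment> \<open>The size is chosen so that \<open>n^2 / N < 1 - \<beta>\<close>; the added 1
    makes this strict and keeps the domain nonempty for all parameters, including
    \<open>n = 0\<close>.\<close>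
  define N :: "real \<Rightarrow> nat \<Rightarrow> nat" where "N \<beta> n = nat \<lceil>(real n)\<^sup>2 / (1 - \<beta>)\<rceil> + 1" for \<beta> n
  let ?X = "\<lambda>(\<epsilon>::real) \<beta> n. {..<N \<beta> n}"
  let ?R = "\<lambda>\<epsilon> \<beta> n. samples (?X \<epsilon> \<beta> n) n"
  let ?M = "\<lambda>\<epsilon> \<beta> n. exp_mechanism \<epsilon> (?R \<epsilon> \<beta> n)"
  have X: "finite (?X \<epsilon> \<beta> n)" "?X \<epsilon> \<beta> n \<noteq> {}" for \<epsilon> \<beta> n
    by (auto simp: N_def lessThan_empty_iff)
  have large: "(real n)\<^sup>2 / card (?X \<epsilon> \<beta> n) < 1 - \<beta>" if "\<beta> \<in> {0<..<1}" for \<epsilon> \<beta> n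
  proof -
    have "(real n)\<^sup>2 / (1 - \<beta>) < real (N \<beta> n)"
      unfolding N_def by linarith
    moreover have "real (N \<beta> n) > 0" by (simp add: N_def)
    ultimately show ?thesis using that by (simp add: field_simps)
  qed
  show ?thesis
  proof (rule exI[of _ ?X], rule exI[of _ ?R], rule exI[of _ ?M], intro conjI allI impI ballI)
    fix \<epsilon> \<beta> :: real and n :: nat
    assume "\<epsilon> > 0"
    note R = finite_samples[OF X(1)] samples_nonempty[OF X(2)]
    show "algorithm (?X \<epsilon> \<beta> n) n (?R \<epsilon> \<beta> n) (?M \<epsilon> \<beta> n)"
      unfolding algorithm_def using set_pmf_exp_mechanism[OF R] by blast
    show "differentially_private (?X \<epsilon> \<beta> n) n (?R \<epsilon> \<beta> n) \<epsilon> 0 (?M \<epsilon> \<beta> n)"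
      using \<open>\<epsilon> > 0\<close> by (intro differentially_private_exp_mechanism R) simp
  next
    fix \<epsilon> \<beta> \<epsilon>' :: "nat \<Rightarrow> real" and n :: "nat \<Rightarrow> nat"
    assume pos: "\<forall>k. \<epsilon> k > 0 \<and> \<beta> k \<in> {0<..<1}"
      and L: "(\<lambda>k. ln (1 / \<beta> k)) \<in> O(\<lambda>k. real (n k))"
      and eps': "\<epsilon>' \<in> o(\<lambda>k. \<epsilon> k * sqrt (real (n k) * ln (1 / \<beta> k)))"
    have "\<forall>\<^sub>F k in sequentially. 4 * \<epsilon>' k < \<epsilon> k * real (n k)"
      using pos by (intro eventually_smallo_linear[OF _ _ L eps']) auto
    then show "\<forall>\<^sub>F k in sequentially.
        \<not> perfectly_generalizing (?X (\<epsilon> k) (\<beta> k) (n k)) (n k) (?R (\<epsilon> k) (\<beta> k) (n k))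
            (\<beta> k) (\<epsilon>' k) 0 (?M (\<epsilon> k) (\<beta> k) (n k))"
    proof eventually_elim
      case (elim k)
      then show ?case
        using pos by (intro not_perfectly_generalizing_exp_mechanism X large) auto
    qed
  qed
qed

end
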